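(* Let $\mathfrak g=\mathfrak{sl}(4|1)$ over $\mathbb{C}$, and let $\mathfrak p,\mathfrak n\subset\mathfrak g$ be the sub-superalgebras $$\mathfrak p=\left\{\begin{pmatrix} L & 0 & 0 \\ M & R & \alpha \\ \beta & 0 & c \end{pmatrix}\right\},\qquad \mathfrak n=\left\{\begin{pmatrix} 0 & A & \gamma \\ 0 & 0 & 0 \\ 0 & \delta & 0 \end{pmatrix}\right\}$$ (blocks of sizes $2,2,1$, with $c=\mathrm{tr}(L)+\mathrm{tr}(R)$). There is a conjugation $\sigma:\mathfrak g\to\mathfrak g$ satisfying the following properties: (1) $\mathfrak g^\sigma$, the set of fixed points of $\sigma$, is the Wess–Zumino superconformal Lie algebra $\mathfrak{su}(2,2|1)$. (2) $\sigma$ leaves $\mathfrak p$ and $\mathfrak n$ invariant as well as the even and odd parts of $\mathfrak g$. (3) $\sigma$ preserves the big cell $\mathfrak c:=\mathfrak n\cap\mathfrak g_0$. (4) $\mathfrak c^\sigma$ consists of all $2\times2$ skew hermitian matrices $A$. (5) The group $L_0^\sigma$ consists of all matrices of the form $\begin{pmatrix} x & 0 \\ 0 & (x^\dagger)^{-1} \end{pmatrix}$, and its action on $\mathfrak c^\sigma$ is $$\begin{pmatrix} 0 & A \\ 0 & 0 \end{pmatrix}\longmapsto\begin{pmatrix} 0 & xAx^\dagger \\ 0 & 0 \end{pmatrix}.$$ It is given by $$\sigma:\begin{pmatrix} X & \mu \\ \nu & x \end{pmatrix}\longmapsto\begin{pmatrix} -FX^\dagger F & iF\nu^\dagger \\ i\mu^\dagger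 F & -\bar x \end{pmatrix},\qquad F=\begin{pmatrix} 0 & I_2 \\ I_2 & 0 \end{pmatrix},$$ where $X$ is a $4\times4$ matrix, $\mu$ is $4\times1$, $\nu$ is $1\times4$, and $x$ is a scalar.
   Context: $\mathfrak{sl}(4|1)$ is the complex Lie superalgebra of $5\times5$ matrices $\begin{pmatrix} X & \mu \\ \nu & x \end{pmatrix}$ with $\mathrm{tr}(X)=x$, with the usual super-commutator; the even part $\mathfrak g_0$ is given by $\mu=0,\nu=0$, the odd part by $X=0,x=0$. A conjugation of a complex Lie superalgebra is an antilinear map $\sigma$ with $\sigma^2=\mathrm{id}$ preserving the super bracket. $\dagger$ is the conjugate transpose. In $\mathfrak p$ and $\mathfrak n$, $L,M,R,A$ are arbitrary complex $2\times2$ matrices, $\alpha,\gamma$ are $2\times1$, $\beta,\delta$ are $1\times2$, and $c$ is a scalar. $\mathfrak c$ is identified with the space of $2\times2$ matrices $A$ (the matrices with upper-middle block $A$ and other blocks zero). $L_0=\{\mathrm{diag}(x,y,1)\mid x,y\in\mathrm{SL}(2,\mathbb{C})\}$ is the simply connected group with Lie algebra $\mathfrak l_0=\{\mathrm{diag}(L,R,0)\mid L,R\in\mathfrak{sl}_2(\mathbb{C})\}$; it acts on $\mathfrak g$ by conjugation, and $L_0^\sigma$ is the fixed-point group of the conjugation of $L_0$ induced by $\sigma$ (in (5) the last row and column are suppressed, and $x\in\mathrm{SL}(2,\mathbb{C})$). $\mathfrak{su}(2,2|1)$ is the real Lie superalgebra, considered up to isomorphism, that is the fixed-point set of the conjugation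 of $\mathfrak{sl}(4|1)$ given by the same formula as in the claim but with $F$ replaced by $\mathrm{diag}(I_2,-I_2)$. *)

theory Defs
  imports "HOL-Analysis.Analysis"
begin

section \<open>Block matrices\<close>

text \<open>Block matrices are indexed by sum types, so a \<open>5 \<times> 5\<close> matrix with blocks of sizes
  2, 2, 1 is indexed by \<open>(2 + 2) + 1\<close>. In \<^typ>\<open>complex^'n^'m\<close> the row index is \<^typ>\<open>'m\<close>.\<close>

definition vstack :: "complex^'n^'a \<Rightarrow> complex^'n^'b \<Rightarrow> complex^'n^('a::finite + 'b::finite)" where
  "vstack A B = (\<chi> i. case i of Inl a \<Rightarrow> A $ a | Inr b \<Rightarrow> B $ b)"

definition hstack :: "complex^'a^'m \<Rightarrow> complex^'b^'m \<Rightarrow> complex^('a::finite + 'b::finite)^'m" where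
  "hstack A B = (\<chi> i j. case j of Inl a \<Rightarrow> A $ i $ a | Inr b \<Rightarrow> B $ i $ b)"

definition blk :: "complex^'a^'a \<Rightarrow> complex^'b^'a \<Rightarrow> complex^'a^'b \<Rightarrow> complex^'b^'b
    \<Rightarrow> complex^('a::finite + 'b::finite)^('a + 'b)" where
  "blk A B C D = vstack (hstack A B) (hstack C D)"

definition ul :: "complex^('a::finite + 'b::finite)^('a + 'b) \<Rightarrow> complex^'a^'a" where
  "ul Z = (\<chi> i j. Z $ Inl i $ Inl j)"
definition ur :: "complex^('a::finite + 'b::finite)^('a + 'b) \<Rightarrow> complex^'b^'a" where
  "ur Z = (\<chi> i j. Z $ Inl i $ Inr j)"
definition ll :: "complex^('a::finite + 'b::finite)^('a + 'b) \<Rightarrow> complex^'a^'b" where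
  "ll Z = (\<chi> i j. Z $ Inr i $ Inl j)"
definition lr :: "complex^('a::finite + 'b::finite)^('a + 'b) \<Rightarrow> complex^'b^'b" where
  "lr Z = (\<chi> i j. Z $ Inr i $ Inr j)"

definition dagger :: "complex^'n^'m \<Rightarrow> complex^'m^'n"  ("_\<^sup>\<dagger>" [1000] 999) where
  "A\<^sup>\<dagger> = (\<chi> i j. cnj (A $ j $ i))"

definition cscale :: "complex \<Rightarrow> complex^'n^'m \<Rightarrow> complex^'n^'m"  (infixr "*\<^sub>m" 75) where
  "c *\<^sub>m A = (\<chi> i j. c * A $ i $ j)"

section \<open>The Lie superalgebra \<open>sl(4|1)\<close>\<close>

type_synonym mat2 = "complex^2^2"
type_synonym mat4 = "complex^(2 + 2)^(2 + 2)"
type_synonym mat5 = "complex^((2 + 2) + 1)^((2 + 2) + 1)"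

definition sl41 :: "mat5 set" where
  "sl41 = {blk X \<mu> \<nu> (mat x) | X \<mu> \<nu> x. trace X = x}"

definition even_sl41 :: "mat5 set" where
  "even_sl41 = {blk X 0 0 (mat x) | X x. trace X = x}"

definition odd_sl41 :: "mat5 set" where
  "odd_sl41 = {blk 0 \<mu> \<nu> 0 | \<mu> \<nu>. True}"

text \<open>The super-commutator is bilinear, so on inhomogeneous elements it is computed from the even
  and odd parts \<open>evp\<close> and \<open>odp\<close>; only the odd-odd contribution is an anticommutator.\<close>

definition evp :: "mat5 \<Rightarrow> mat5" where "evp Z = blk (ul Z) 0 0 (lr Z)"
definition odp :: "mat5 \<Rightarrow> mat5" where "odp Z = blk 0 (ur Z) (ll Z) 0"

definition sbr :: "mat5 \<Rightarrow> mat5 \<Rightarrow> mat5" where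
  "sbr Z W = (evp Z ** evp W - evp W ** evp Z) + (evp Z ** odp W - odp W ** evp Z)
           + (odp Z ** evp W - evp W ** odp Z) + (odp Z ** odp W + odp W ** odp Z)"

definition conjugation :: "(mat5 \<Rightarrow> mat5) \<Rightarrow> bool" where
  "conjugation \<sigma> \<longleftrightarrow>
     (\<forall>Z\<in>sl41. \<sigma> Z \<in> sl41) \<and>
     (\<forall>Z\<in>sl41. \<forall>W\<in>sl41. \<sigma> (Z + W) = \<sigma> Z + \<sigma> W) \<and>
     (\<forall>c. \<forall>Z\<in>sl41. \<sigma> (c *\<^sub>m Z) = cnj c *\<^sub>m \<sigma> Z) \<and>
     (\<forall>Z\<in>sl41. \<sigma> (\<sigma> Z) = Z) \<and>
     (\<forall>Z\<in>sl41. \<forall>W\<in>sl41. \<sigma> (sbr Z W) = sbr (\<sigma> Z) (\<sigma> W))"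

definition pp :: "mat5 set" where
  "pp = {blk (blk L 0 M R) (vstack 0 \<alpha>) (hstack \<beta> 0) (mat c) | L M R \<alpha> \<beta> c.
           c = trace L + trace R}"

definition nn :: "mat5 set" where
  "nn = {blk (blk 0 A 0 0) (vstack \<gamma> 0) (hstack 0 \<delta>) 0 | A \<gamma> \<delta>. True}"

definition fixpts :: "(mat5 \<Rightarrow> mat5) \<Rightarrow> mat5 set \<Rightarrow> mat5 set" where
  "fixpts \<sigma> S = {Z \<in> S. \<sigma> Z = Z}"

section \<open>Real Lie superalgebras and \<open>su(2,2|1)\<close>\<close>

definition real_subsuperalg :: "mat5 set \<Rightarrow> bool" where
  "real_subsuperalg S \<longleftrightarrow> S \<subseteq> sl41 \<and> subspace S \<and>
     (\<forall>Z\<in>S. evp Z \<in> S \<and> odp Z \<in> S) \<and> (\<forall>Z\<in>S. \<forall>W\<in>S. sbr Z W \<in> S)"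

definition real_superalg_iso :: "mat5 set \<Rightarrow> mat5 set \<Rightarrow> bool" where
  "real_superalg_iso S T \<longleftrightarrow> real_subsuperalg S \<and> real_subsuperalg T \<and>
     (\<exists>\<phi>. bij_betw \<phi> S T \<and>
        (\<forall>Z\<in>S. \<forall>W\<in>S. \<phi> (Z + W) = \<phi> Z + \<phi> W) \<and>
        (\<forall>r. \<forall>Z\<in>S. \<phi> (r *\<^sub>R Z) = r *\<^sub>R \<phi> Z) \<and>
        \<phi> ` (S \<inter> even_sl41) = T \<inter> even_sl41 \<and>
        \<phi> ` (S \<inter> odd_sl41) = T \<inter> odd_sl41 \<and>
        (\<forall>Z\<in>S. \<forall>W\<in>S. \<phi> (sbr Z W) = sbr (\<phi> Z) (\<phi> W)))"

definition sigma :: "mat4 \<Rightarrow> mat5 \<Rightarrow> mat5" where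
  "sigma H Z = blk (- (H ** (ul Z)\<^sup>\<dagger> ** H)) (\<i> *\<^sub>m (H ** (ll Z)\<^sup>\<dagger>))
                   (\<i> *\<^sub>m ((ur Z)\<^sup>\<dagger> ** H)) (- (lr Z)\<^sup>\<dagger>)"

definition FF :: mat4 where "FF = blk 0 (mat 1) (mat 1) 0"
definition JJ :: mat4 where "JJ = blk (mat 1) 0 0 (- mat 1)"

text \<open>\<open>su(2,2|1)\<close> is only meant up to isomorphism; \<open>su22_1\<close> is the representative attached to
  the diagonal form \<open>JJ\<close>.\<close>

definition su22_1 :: "mat5 set" where "su22_1 = fixpts (sigma JJ) sl41"

section \<open>The big cell and the group \<open>L\<^sub>0\<close>\<close>

definition big_cell :: "mat5 set" where "big_cell = nn \<inter> even_sl41"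

definition cell :: "mat2 \<Rightarrow> mat5" where "cell A = blk (blk 0 A 0 0) 0 0 0"

definition lie0 :: "mat5 set" where
  "lie0 = {blk (blk L 0 0 R) 0 0 0 | L R. trace L = 0 \<and> trace R = 0}"

definition L0 :: "mat5 set" where
  "L0 = {blk (blk x 0 0 y) 0 0 (mat 1) | x y. det x = 1 \<and> det y = 1}"

definition conj_act :: "mat5 \<Rightarrow> mat5 \<Rightarrow> mat5" where
  "conj_act g Z = g ** Z ** matrix_inv g"

text \<open>A conjugation of \<open>L\<^sub>0\<close> is induced by \<open>\<sigma>\<close> if it is an involutive group automorphism whose
  differential at the identity, computed on curves, is \<open>\<sigma>\<close> restricted to \<open>lie0\<close>. A group
  homomorphism that is differentiable at the identity is smooth, so no further regularity is
  required; antiholomorphy comes from the antilinearity of \<open>\<sigma>\<close>. Maps are normalised to be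
  undefined off \<open>L0\<close> so that uniqueness makes sense.\<close>

definition induced_by :: "(mat5 \<Rightarrow> mat5) \<Rightarrow> (mat5 \<Rightarrow> mat5) \<Rightarrow> bool" where
  "induced_by \<sigma> \<Sigma> \<longleftrightarrow> \<Sigma> \<in> L0 \<rightarrow>\<^sub>E L0 \<and>
     (\<forall>g\<in>L0. \<forall>h\<in>L0. \<Sigma> (g ** h) = \<Sigma> g ** \<Sigma> h) \<and>
     (\<forall>g\<in>L0. \<Sigma> (\<Sigma> g) = g) \<and>
     (\<forall>\<gamma> Z. (\<forall>t::real. \<gamma> t \<in> L0) \<and> \<gamma> 0 = mat 1 \<and> Z \<in> lie0 \<and> (\<gamma> has_vector_derivative Z) (at 0)
        \<longrightarrow> ((\<lambda>t. \<Sigma> (\<gamma> t)) has_vector_derivative \<sigma> Z) (at 0))"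

definition L0_fix :: "(mat5 \<Rightarrow> mat5) \<Rightarrow> mat5 set" where
  "L0_fix \<sigma> = {g \<in> L0. (THE \<Sigma>. induced_by \<sigma> \<Sigma>) g = g}"

section \<open>Checks of the definitions\<close>

lemma blk_sel [simp]:
  "ul (blk A B C D) = A" "ur (blk A B C D) = B" "ll (blk A B C D) = C" "lr (blk A B C D) = D"
  by (simp_all add: ul_def ur_def ll_def lr_def blk_def vstack_def hstack_def vec_eq_iff)

lemma blk_collapse [simp]: "blk (ul Z) (ur Z) (ll Z) (lr Z) = Z"
  by (auto simp: ul_def ur_def ll_def lr_def blk_def vstack_def hstack_def vec_eq_iff split: sum.split)

lemma blk_eq_iff [simp]: "blk A B C D = blk A' B' C' D' \<longleftrightarrow> A = A' \<and> B = B' \<and> C = C' \<and> D = D'"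
  by (metis blk_sel)

lemma sum_univ_plus:
  "(\<Sum>i\<in>(UNIV :: ('a::finite + 'b::finite) set). f i) = (\<Sum>a\<in>UNIV. f (Inl a)) + (\<Sum>b\<in>UNIV. f (Inr b))"
  using sum.Plus[of "UNIV :: 'a set" "UNIV :: 'b set" f] by (simp add: comp_def)

lemma blk_mult: "blk A B C D ** blk A' B' C' D' =
    blk (A ** A' + B ** C') (A ** B' + B ** D') (C ** A' + D ** C') (C ** B' + D ** D')"
  by (auto simp: blk_def vstack_def hstack_def vec_eq_iff matrix_matrix_mult_def sum_univ_plus
      split: sum.split)

lemma sigma_blk: "sigma H (blk X \<mu> \<nu> (mat x)) =
    blk (- (H ** X\<^sup>\<dagger> ** H)) (\<i> *\<^sub>m (H ** \<nu>\<^sup>\<dagger>)) (\<i> *\<^sub>m (\<mu>\<^sup>\<dagger> ** H)) (mat (- cnj x))"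
proof -
  have "- (mat x :: complex^1^1)\<^sup>\<dagger> = mat (- cnj x)"
    by (simp add: dagger_def mat_def vec_eq_iff)
  then show ?thesis by (simp add: sigma_def)
qed

lemma blk_add: "blk A B C D + blk A' B' C' D' = blk (A + A') (B + B') (C + C') (D + D')"
  by (auto simp: blk_def vstack_def hstack_def vec_eq_iff split: sum.split)

lemma blk_cscale: "c *\<^sub>m blk A B C D = blk (c *\<^sub>m A) (c *\<^sub>m B) (c *\<^sub>m C) (c *\<^sub>m D)"
  by (auto simp: cscale_def blk_def vstack_def hstack_def vec_eq_iff split: sum.split)

lemma blk_diff: "blk A B C D - blk A' B' C' D' = blk (A - A') (B - B') (C - C') (D - D')"
  by (auto simp: blk_def vstack_def hstack_def vec_eq_iff split: sum.split)

lemma stack_mult: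
  "blk A B C D ** vstack P Q = vstack (A ** P + B ** Q) (C ** P + D ** Q)"
  "hstack P' Q' ** blk A B C D = hstack (P' ** A + Q' ** C) (P' ** B + Q' ** D)"
  "hstack P' Q' ** vstack P Q = P' ** P + Q' ** Q"
  "vstack P Q ** hstack P' Q' = blk (P ** P') (P ** Q') (Q ** P') (Q ** Q')"
  by (auto simp: blk_def vstack_def hstack_def vec_eq_iff matrix_matrix_mult_def sum_univ_plus
      split: sum.split)

lemma stack_arith:
  "vstack P Q + vstack P' Q' = vstack (P + P') (Q + Q')"
  "vstack P Q - vstack P' Q' = vstack (P - P') (Q - Q')"
  "hstack R S + hstack R' S' = hstack (R + R') (S + S')"
  "hstack R S - hstack R' S' = hstack (R - R') (S - S')"
  "c *\<^sub>m vstack P Q = vstack (c *\<^sub>m P) (c *\<^sub>m Q)"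
  "c *\<^sub>m hstack R S = hstack (c *\<^sub>m R) (c *\<^sub>m S)"
  by (auto simp: cscale_def vstack_def hstack_def vec_eq_iff split: sum.split)

lemma zero_stack: "vstack 0 0 = 0" "hstack 0 0 = 0" "blk 0 0 0 0 = 0"
  by (auto simp: blk_def vstack_def hstack_def vec_eq_iff split: sum.split)

lemma cscale_zero [simp]: "c *\<^sub>m 0 = 0" "c *\<^sub>m mat x = mat (c * x)"
  by (auto simp: cscale_def mat_def vec_eq_iff)

lemma mat_arith: "mat x + mat y = (mat (x + y) :: complex^'n^'n)"
  "mat x - mat y = (mat (x - y) :: complex^'n^'n)"
  "(mat 0 :: complex^'n^'n) = 0"
  by (auto simp: mat_def vec_eq_iff)

lemma mat1_trace: "(A :: complex^1^1) = mat (trace A)"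
  by (auto simp: mat_def vec_eq_iff trace_def UNIV_1)

lemma trace_blk: "trace (blk A B C D) = trace A + trace D"
  by (simp add: trace_def sum_univ_plus blk_def vstack_def hstack_def)

lemma trace_cscale: "trace (c *\<^sub>m A) = c * trace A"
  by (simp add: trace_def cscale_def sum_distrib_left)

lemma trace_mult_commute: "trace ((A :: complex^'n^'m) ** B) = trace (B ** A)"
  by (simp add: trace_def matrix_matrix_mult_def, subst sum.swap, simp add: mult.commute)

lemma mat_mult_mat: "mat x ** mat y = (mat (x * y) :: complex^1^1)"
  by (simp add: matrix_matrix_mult_def mat_def vec_eq_iff UNIV_1)

lemma mult_zero_m [simp]: "(0 :: complex^'n^'m) ** B = 0" "A ** (0 :: complex^'n^'m) = 0"
  by (simp_all add: matrix_matrix_mult_def vec_eq_iff)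

lemma sbr_blk: "sbr (blk A B C D) (blk A' B' C' D') =
   blk (A ** A' - A' ** A + (B ** C' + B' ** C)) (A ** B' - B' ** D + (B ** D' - A' ** B))
       (D ** C' - C' ** A + (C ** A' - D' ** C)) (D ** D' - D' ** D + (C ** B' + C' ** B))"
  by (simp add: sbr_def evp_def odp_def blk_mult blk_add blk_diff algebra_simps)

definition complex_subsuperalg :: "mat5 set \<Rightarrow> bool" where
  "complex_subsuperalg S \<longleftrightarrow> S \<subseteq> sl41 \<and> 0 \<in> S \<and> (\<forall>Z\<in>S. \<forall>W\<in>S. Z + W \<in> S) \<and>
     (\<forall>c. \<forall>Z\<in>S. c *\<^sub>m Z \<in> S) \<and> (\<forall>Z\<in>S. evp Z \<in> S \<and> odp Z \<in> S) \<and>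
     (\<forall>Z\<in>S. \<forall>W\<in>S. sbr Z W \<in> S)"

lemma sl41_alt: "Z \<in> sl41 \<longleftrightarrow> trace (ul Z) = trace (lr Z)"
proof
  assume "Z \<in> sl41"
  then show "trace (ul Z) = trace (lr Z)"
    by (auto simp: sl41_def trace_def mat_def UNIV_1)
next
  assume "trace (ul Z) = trace (lr Z)"
  then have "Z = blk (ul Z) (ur Z) (ll Z) (mat (trace (lr Z)))"
    by (metis blk_collapse mat1_trace)
  then show "Z \<in> sl41" unfolding sl41_def
    using \<open>trace (ul Z) = trace (lr Z)\<close> by blast
qed

lemma complex_subsuperalg_sl41: "complex_subsuperalg sl41"
proof -
  have t: "ul (Z + W) = ul Z + ul W" "lr (Z + W) = lr Z + lr W"
    "ul (c *\<^sub>m Z) = c *\<^sub>m ul Z" "lr (c *\<^sub>m Z) = c *\<^sub>m lr Z" "ul 0 = 0" "lr 0 = 0"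
    for Z W :: mat5 and c
    by (auto simp: ul_def lr_def cscale_def vec_eq_iff)
  have z: "trace (0 :: complex^'n^'n) = 0" by (simp add: trace_def)
  have "sbr Z W \<in> sl41" for Z W
  proof -
    have "sbr Z W = sbr (blk (ul Z) (ur Z) (ll Z) (lr Z)) (blk (ul W) (ur W) (ll W) (lr W))"
      by simp
    then show ?thesis
      unfolding sl41_alt
      using trace_mult_commute[of "ul Z" "ul W"] trace_mult_commute[of "lr Z" "lr W"]
        trace_mult_commute[of "ur Z" "ll W"] trace_mult_commute[of "ur W" "ll Z"]
      by (simp add: sbr_blk trace_add trace_sub del: blk_collapse)
  qed
  then show ?thesis
    by (simp add: complex_subsuperalg_def)
       (simp add: sl41_alt t trace_add trace_cscale evp_def odp_def z)
qed

lemma pp_iff: "Z \<in> pp \<longleftrightarrow> Z \<in> sl41 \<and> ur (ul Z) = 0 \<and>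
    (\<exists>\<alpha>. ur Z = vstack 0 \<alpha>) \<and> (\<exists>\<beta>. ll Z = hstack \<beta> 0)"
proof
  assume "Z \<in> pp" then show "Z \<in> sl41 \<and> ur (ul Z) = 0 \<and>
    (\<exists>\<alpha>. ur Z = vstack 0 \<alpha>) \<and> (\<exists>\<beta>. ll Z = hstack \<beta> 0)"
    by (auto simp: pp_def sl41_def trace_blk)
next
  assume a: "Z \<in> sl41 \<and> ur (ul Z) = 0 \<and> (\<exists>\<alpha>. ur Z = vstack 0 \<alpha>) \<and> (\<exists>\<beta>. ll Z = hstack \<beta> 0)"
  then obtain X \<mu> \<nu> x where Z: "Z = blk X \<mu> \<nu> (mat x)" "trace X = x" by (auto simp: sl41_def)
  have X: "X = blk (ul X) 0 (ll X) (lr X)" using a Z by (metis blk_collapse blk_sel(1))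
  then have "x = trace (ul X) + trace (lr X)" using Z(2) trace_blk by metis
  then show "Z \<in> pp" unfolding pp_def using a Z X by (simp, metis)
qed

lemma complex_subsuperalg_pp: "complex_subsuperalg pp"
proof -
  have sl: "pp \<subseteq> sl41" using pp_iff by blast
  have c: "Z + W \<in> pp \<and> c *\<^sub>m Z \<in> pp \<and> evp Z \<in> pp \<and> odp Z \<in> pp \<and> sbr Z W \<in> pp"
    if Z: "Z \<in> pp" and W: "W \<in> pp" for Z W c
  proof -
    from Z obtain L M R \<alpha> \<beta> x where
      Z': "Z = blk (blk L 0 M R) (vstack 0 \<alpha>) (hstack \<beta> 0) (mat x)" by (auto simp: pp_def)
    from W obtain L' M' R' \<alpha>' \<beta>' x' where
      W': "W = blk (blk L' 0 M' R') (vstack 0 \<alpha>') (hstack \<beta>' 0) (mat x')" by (auto simp: pp_def)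
    have Zs: "Z \<in> sl41" and Ws: "W \<in> sl41" using sl Z W by auto
    have s: "Z + W \<in> sl41" "c *\<^sub>m Z \<in> sl41" "evp Z \<in> sl41" "odp Z \<in> sl41" "sbr Z W \<in> sl41"
      using complex_subsuperalg_sl41 Zs Ws unfolding complex_subsuperalg_def by blast+
    have z: "vstack 0 \<alpha> ** mat x = vstack 0 (\<alpha> ** mat x)"
      "mat x ** hstack \<beta> 0 = hstack (mat x ** \<beta>) 0"
      for \<alpha> :: "complex^1^2" and \<beta> :: "complex^2^1" and x
      by (auto simp: vstack_def hstack_def vec_eq_iff matrix_matrix_mult_def split: sum.split)
    have I: "blk (blk L 0 M R) (vstack 0 \<alpha>) (hstack \<beta> 0) D \<in> pp"
      if "blk (blk L 0 M R) (vstack 0 \<alpha>) (hstack \<beta> 0) D \<in> sl41" for L M R \<alpha> \<beta> D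
      using that unfolding pp_iff by (simp, metis)
    have zz: "blk 0 0 0 0 = (0 :: mat4)" by (rule zero_stack)
    have "Z + W \<in> pp"
      using s(1) by (simp add: Z' W' blk_add stack_arith I)
    moreover have "c *\<^sub>m Z \<in> pp"
      using s(2) by (simp add: Z' blk_cscale stack_arith I del: cscale_zero(2))
    moreover have "evp Z \<in> pp"
      using s(3) I[of L M R 0 0 "mat x"] by (simp add: Z' evp_def zero_stack)
    moreover have "odp Z \<in> pp"
      using s(4) I[of 0 0 0 \<alpha> \<beta> 0] by (simp add: Z' odp_def zero_stack)
    moreover have "sbr Z W \<in> pp"
      using s(5) by (simp add: Z' W' sbr_blk blk_add blk_diff blk_mult stack_mult stack_arith z I)
    ultimately show ?thesis by blast
  qed
  have "0 \<in> pp"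
  proof -
    have "blk (blk 0 0 0 0) (vstack 0 0) (hstack 0 0) (mat 0) \<in> pp"
      unfolding pp_def by (force simp: trace_def)
    then show ?thesis by (simp add: zero_stack mat_arith)
  qed
  then show ?thesis using c sl by (simp add: complex_subsuperalg_def)
qed

lemma complex_subsuperalg_nn: "complex_subsuperalg nn"
proof -
  have nnI: "blk (blk 0 A 0 0) (vstack \<gamma> 0) (hstack 0 \<delta>) 0 \<in> nn" for A \<gamma> \<delta>
    unfolding nn_def by blast
  have sl: "nn \<subseteq> sl41"
    by (auto simp: nn_def sl41_alt trace_blk) (simp_all add: trace_def)
  have z0: "0 = vstack 0 0" "0 = hstack 0 0" "0 = blk 0 0 0 0"
    by (simp_all add: zero_stack)
  have c: "Z + W \<in> nn \<and> c *\<^sub>m Z \<in> nn \<and> evp Z \<in> nn \<and> odp Z \<in> nn \<and> sbr Z W \<in> nn"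
    if Z: "Z \<in> nn" and W: "W \<in> nn" for Z W c
  proof -
    from Z obtain A \<gamma> \<delta> where
      Z': "Z = blk (blk 0 A 0 0) (vstack \<gamma> 0) (hstack 0 \<delta>) 0" by (auto simp: nn_def)
    from W obtain A' \<gamma>' \<delta>' where
      W': "W = blk (blk 0 A' 0 0) (vstack \<gamma>' 0) (hstack 0 \<delta>') 0" by (auto simp: nn_def)
    have "evp Z \<in> nn" using nnI[of A 0 0] by (simp add: Z' evp_def zero_stack)
    moreover have "odp Z \<in> nn" using nnI[of 0 \<gamma> \<delta>] by (simp add: Z' odp_def zero_stack)
    moreover have "Z + W \<in> nn" "c *\<^sub>m Z \<in> nn"
      by (simp_all add: Z' W' blk_add blk_cscale stack_arith nnI)
    moreover have "sbr Z W \<in> nn"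
      using nnI[of "\<gamma> ** \<delta>' + \<gamma>' ** \<delta>" 0 0]
      by (simp add: Z' W' sbr_blk blk_add blk_diff blk_mult stack_mult stack_arith zero_stack)
    ultimately show ?thesis by blast
  qed
  have "0 \<in> nn" using nnI[of 0 0 0] by (simp add: zero_stack)
  then show ?thesis using c sl by (simp add: complex_subsuperalg_def)
qed

end

theory Submission
  imports Defs
begin

text \<open>For any \<open>H\<close> with \<open>H\<^sup>\<dagger> = H\<close> and \<open>H\<^sup>2 = 1\<close>, the formula for \<open>\<sigma>\<close> defines a conjugation. The forms
  \<open>FF\<close> and \<open>JJ\<close> are conjugate under a Hermitian involution \<open>UU\<close>, which gives the isomorphism of the
  real forms.

  On \<open>L\<^sub>0\<close> the inverse of \<open>x \<in> SL(2)\<close> is the adjugate \<open>tr(x) - x\<close>, so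
  \<open>diag(x, y, 1) \<mapsto> diag((y\<^sup>\<dagger>)\<inverse>, (x\<^sup>\<dagger>)\<inverse>, 1)\<close> is the restriction of a real linear map, and its
  differential is that map itself, which on traceless blocks is \<open>\<sigma>\<close>. For uniqueness, if \<open>Z\<^sup>2 = 0\<close> then
  an induced \<open>\<Sigma>\<close> maps the one-parameter group \<open>1 + s Z\<close> to one with generator
  \<open>\<sigma> Z\<close> of square zero, hence to \<open>1 + s \<sigma> Z\<close>; such unipotent elements generate \<open>L\<^sub>0\<close>.\<close>

section \<open>Matrix algebra\<close>

lemma matrix_mult_minus:
  "(- A) ** B = - (A ** B)" "A ** (- B) = - (A ** B)"
  for A :: "complex^'n^'m" and B :: "complex^'k^'n"
  by (simp_all add: matrix_matrix_mult_def vec_eq_iff sum_negf)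

lemma matrix_add_rdistrib: "(A + A') ** B = A ** B + A' ** B"
  for A :: "complex^'n^'m" and B :: "complex^'k^'n"
  by (simp add: matrix_matrix_mult_def vec_eq_iff sum.distrib algebra_simps)

lemma matrix_mult_diff:
  "(A - A') ** B = A ** B - A' ** B" "A ** (B - B') = A ** B - A ** B'"
  for A :: "complex^'n^'m" and B :: "complex^'k^'n"
  by (simp_all add: matrix_matrix_mult_def vec_eq_iff sum_subtractf algebra_simps)

lemma matrix_mult_cscale:
  "(c *\<^sub>m A) ** B = c *\<^sub>m (A ** B)" "A ** (c *\<^sub>m B) = c *\<^sub>m (A ** B)"
  by (simp_all add: matrix_matrix_mult_def cscale_def vec_eq_iff sum_distrib_left algebra_simps)

lemma matrix_mult_scaleR:
  "(r *\<^sub>R A) ** B = r *\<^sub>R (A ** B)" "A ** (r *\<^sub>R B) = r *\<^sub>R (A ** B)"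
  for A :: "complex^'n^'m" and B :: "complex^'k^'n"
  by (simp_all add: matrix_matrix_mult_def vec_eq_iff scaleR_right.sum)

lemma cscale_simps:
  "c *\<^sub>m (A + B) = c *\<^sub>m A + c *\<^sub>m B" "c *\<^sub>m (A - B) = c *\<^sub>m A - c *\<^sub>m B"
  "c *\<^sub>m (- A) = - (c *\<^sub>m A)" "c *\<^sub>m d *\<^sub>m A = (c * d) *\<^sub>m A"
  "1 *\<^sub>m A = A" "(- c) *\<^sub>m A = - (c *\<^sub>m A)"
  by (auto simp: cscale_def vec_eq_iff algebra_simps)

lemma scaleR_cscale: "r *\<^sub>R A = complex_of_real r *\<^sub>m A"
  unfolding vec_eq_iff cscale_def by (simp add: scaleR_conv_of_real[of r "_ :: complex"])

lemma dagger_simps: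
  "(A + B)\<^sup>\<dagger> = A\<^sup>\<dagger> + B\<^sup>\<dagger>" "(A - B)\<^sup>\<dagger> = A\<^sup>\<dagger> - B\<^sup>\<dagger>" "(- A)\<^sup>\<dagger> = - A\<^sup>\<dagger>"
  "(c *\<^sub>m A)\<^sup>\<dagger> = cnj c *\<^sub>m A\<^sup>\<dagger>" "(A\<^sup>\<dagger>)\<^sup>\<dagger> = A" "(r *\<^sub>R A)\<^sup>\<dagger> = r *\<^sub>R A\<^sup>\<dagger>"
  "0\<^sup>\<dagger> = 0"
  by (simp_all add: dagger_def cscale_def vec_eq_iff)

lemma dagger_mat: "(mat x)\<^sup>\<dagger> = mat (cnj x)"
  by (auto simp: dagger_def mat_def vec_eq_iff)

lemma dagger_mult: "(A ** B)\<^sup>\<dagger> = B\<^sup>\<dagger> ** A\<^sup>\<dagger>"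
  by (simp add: dagger_def matrix_matrix_mult_def vec_eq_iff mult.commute)

lemma dagger_blk: "(blk A B C D)\<^sup>\<dagger> = blk (A\<^sup>\<dagger>) (C\<^sup>\<dagger>) (B\<^sup>\<dagger>) (D\<^sup>\<dagger>)"
  by (auto simp: dagger_def blk_def vstack_def hstack_def vec_eq_iff split: sum.split)

lemma dagger_stack: "(vstack P Q)\<^sup>\<dagger> = hstack (P\<^sup>\<dagger>) (Q\<^sup>\<dagger>)" "(hstack R S)\<^sup>\<dagger> = vstack (R\<^sup>\<dagger>) (S\<^sup>\<dagger>)"
  by (auto simp: dagger_def vstack_def hstack_def vec_eq_iff split: sum.split)

lemma trace_dagger: "trace (A\<^sup>\<dagger>) = cnj (trace A)"
  by (simp add: trace_def dagger_def)

lemma trace_minus: "trace (- A :: complex^'n^'n) = - trace A"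
  by (simp add: trace_def sum_negf)

lemma blk_scaleR: "r *\<^sub>R blk A B C D = blk (r *\<^sub>R A) (r *\<^sub>R B) (r *\<^sub>R C) (r *\<^sub>R D)"
  by (simp add: scaleR_cscale blk_cscale)

lemma blk_minus: "- blk A B C D = blk (- A) (- B) (- C) (- D)"
  using blk_cscale[of "-1"] by (simp add: cscale_simps)

lemma blk_mat1: "blk (mat 1) 0 0 (mat 1) = mat 1"
  by (auto simp: blk_def vstack_def hstack_def vec_eq_iff mat_def split: sum.split)

lemma blk_cases: obtains A B C D where "Z = blk A B C D"
  by (metis blk_collapse)

lemmas mat_ring = matrix_mult_minus matrix_mult_diff matrix_mult_cscale matrix_add_ldistrib
  matrix_add_rdistrib matrix_mul_assoc

section \<open>The conjugation attached to a Hermitian involution\<close>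

lemma sigma_blk_general: "sigma H (blk A B C D) =
    blk (- (H ** A\<^sup>\<dagger> ** H)) (\<i> *\<^sub>m (H ** C\<^sup>\<dagger>)) (\<i> *\<^sub>m (B\<^sup>\<dagger> ** H)) (- D\<^sup>\<dagger>)"
  by (simp add: sigma_def)

lemma sigma_add: "sigma H (Z + W) = sigma H Z + sigma H W"
  by (cases Z rule: blk_cases, cases W rule: blk_cases)
    (simp add: sigma_blk_general blk_add dagger_simps mat_ring cscale_simps)

lemma sigma_cscale: "sigma H (c *\<^sub>m Z) = cnj c *\<^sub>m sigma H Z"
  by (cases Z rule: blk_cases)
    (simp add: sigma_blk_general blk_cscale dagger_simps mat_ring cscale_simps mult.commute)

lemma evp_blk: "evp (blk A B C D) = blk A 0 0 D" and odp_blk: "odp (blk A B C D) = blk 0 B C 0"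
  by (simp_all add: evp_def odp_def)

lemma sigma_evp: "sigma H (evp Z) = evp (sigma H Z)" and sigma_odp: "sigma H (odp Z) = odp (sigma H Z)"
  by (cases Z rule: blk_cases; simp add: sigma_blk_general evp_blk odp_blk dagger_simps)+

text \<open>Parity as a fixed-point condition: a map that preserves \<open>sl41\<close> and commutes
  with \<open>evp\<close> then preserves the even part at once.\<close>

lemma even_sl41_iff: "Z \<in> even_sl41 \<longleftrightarrow> Z \<in> sl41 \<and> evp Z = Z"
proof
  assume "Z \<in> even_sl41" then show "Z \<in> sl41 \<and> evp Z = Z"
    unfolding even_sl41_def sl41_def by (auto simp: evp_blk)
next
  assume "Z \<in> sl41 \<and> evp Z = Z" then show "Z \<in> even_sl41"
    unfolding even_sl41_def sl41_def by (auto simp: evp_blk)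
qed

lemma odd_sl41_iff: "Z \<in> odd_sl41 \<longleftrightarrow> Z \<in> sl41 \<and> odp Z = Z"
proof
  assume "Z \<in> odd_sl41" then show "Z \<in> sl41 \<and> odp Z = Z"
    unfolding odd_sl41_def by (auto simp: odp_blk sl41_alt) (simp add: trace_def)
next
  assume "Z \<in> sl41 \<and> odp Z = Z" then show "Z \<in> odd_sl41"
    unfolding odd_sl41_def by (metis (mono_tags, lifting) mem_Collect_eq odp_def)
qed

locale herm_invol =
  fixes H :: mat4
  assumes H_dagger: "H\<^sup>\<dagger> = H" and H_sq: "H ** H = mat 1"
begin

lemma H_cancel: "X ** H ** H = X" "H ** (H ** Y) = Y"
  by (metis H_sq matrix_mul_assoc matrix_mul_rid, metis H_sq matrix_mul_assoc matrix_mul_lid)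

lemma sigma_sigma: "sigma H (sigma H Z) = Z"
  by (cases Z rule: blk_cases)
    (simp add: sigma_blk_general dagger_simps dagger_mult H_dagger H_sq H_cancel mat_ring cscale_simps)

text \<open>The dagger reverses products. In a commutator this costs a sign, which the minus in
  front of the even blocks repairs; in the odd-odd anticommutator it costs none, and there the two
  factors \<open>\<i>\<close> multiply to the required -1.\<close>

lemma sigma_sbr: "sigma H (sbr Z W) = sbr (sigma H Z) (sigma H W)"
  by (cases Z rule: blk_cases, cases W rule: blk_cases)
    (simp add: sigma_blk_general sbr_blk dagger_simps dagger_mult H_dagger H_sq H_cancel mat_ring
      cscale_simps)

lemma sigma_sl41: "Z \<in> sl41 \<Longrightarrow> sigma H Z \<in> sl41"
  using trace_mult_commute[of "H ** (ul Z)\<^sup>\<dagger>" H]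
  by (simp add: sl41_alt sigma_def trace_minus trace_dagger matrix_mul_assoc H_sq)

lemma conjugation_sigma: "conjugation (sigma H)"
  by (simp add: conjugation_def sigma_sl41 sigma_add sigma_cscale sigma_sigma sigma_sbr)

lemma real_subsuperalg_fixpts: "real_subsuperalg (fixpts (sigma H) sl41)"
proof -
  have "sigma H 0 = 0"
    using sigma_add[of H 0 0] by simp
  then show ?thesis
    using complex_subsuperalg_sl41
    by (auto simp: real_subsuperalg_def fixpts_def complex_subsuperalg_def subspace_def sigma_add
        scaleR_cscale sigma_cscale sigma_sbr sigma_evp sigma_odp)
qed

text \<open>An involution that maps a set into itself maps it onto itself.\<close>

lemma image_sigma_eq:
  assumes "\<And>Z. Z \<in> S \<Longrightarrow> sigma H Z \<in> S"
  shows "sigma H ` S = S"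
proof
  show "S \<subseteq> sigma H ` S"
    using assms by (metis image_eqI sigma_sigma subsetI)
qed (use assms in blast)

lemma sigma_even: "sigma H ` even_sl41 = even_sl41" and sigma_odd: "sigma H ` odd_sl41 = odd_sl41"
  by (rule image_sigma_eq; simp add: even_sl41_iff odd_sl41_iff sigma_sl41 flip: sigma_evp sigma_odp)+

end

lemma herm_invol_FF: "herm_invol FF"
  by unfold_locales (simp_all add: FF_def dagger_blk dagger_mat dagger_simps blk_mult blk_mat1)

lemma herm_invol_JJ: "herm_invol JJ"
  by unfold_locales (simp_all add: JJ_def dagger_blk dagger_mat dagger_simps blk_mult blk_mat1 mat_ring)

section \<open>The isomorphism with \<open>su(2,2|1)\<close>\<close>

text \<open>When \<open>U ** U = mat 1\<close>, this is conjugation by the even block matrix diag(U,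
  1), which is its own inverse.\<close>

definition even_conj :: "mat4 \<Rightarrow> mat5 \<Rightarrow> mat5" where
  "even_conj U Z = blk (U ** ul Z ** U) (U ** ur Z) (ll Z ** U) (lr Z)"

lemma even_conj_blk: "even_conj U (blk A B C D) = blk (U ** A ** U) (U ** B) (C ** U) D"
  by (simp add: even_conj_def)

context herm_invol
begin

lemma even_conj_add: "even_conj H (Z + W) = even_conj H Z + even_conj H W"
  by (cases Z rule: blk_cases, cases W rule: blk_cases)
    (simp add: even_conj_blk blk_add mat_ring)

lemma even_conj_scaleR: "even_conj H (r *\<^sub>R Z) = r *\<^sub>R even_conj H Z"
  by (cases Z rule: blk_cases) (simp add: even_conj_blk blk_scaleR matrix_mult_scaleR)

lemma even_conj_sbr: "even_conj H (sbr Z W) = sbr (even_conj H Z) (even_conj H W)"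
  by (cases Z rule: blk_cases, cases W rule: blk_cases)
    (simp add: even_conj_blk sbr_blk H_sq H_cancel mat_ring)

lemma even_conj_even_conj: "even_conj H (even_conj H Z) = Z"
  by (cases Z rule: blk_cases) (simp add: even_conj_blk H_sq H_cancel mat_ring)

lemma even_conj_parity: "evp (even_conj H Z) = even_conj H (evp Z)"
    "odp (even_conj H Z) = even_conj H (odp Z)"
  by (cases Z rule: blk_cases; simp add: even_conj_blk evp_blk odp_blk)+

lemma even_conj_sl41: "Z \<in> sl41 \<Longrightarrow> even_conj H Z \<in> sl41"
  using trace_mult_commute[of "H ** ul Z" H]
  by (simp add: sl41_alt even_conj_def matrix_mul_assoc H_sq)

text \<open>Since \<open>H\<close> is a Hermitian involution, the hypothesis says L = HKH, so the
  change of basis by \<open>H\<close> carries the form \<open>K\<close> to the form \<open>L\<close>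
  and intertwines their conjugations.\<close>

lemma even_conj_sigma:
  assumes "H ** K = L ** H"
  shows "even_conj H (sigma K Z) = sigma L (even_conj H Z)"
proof -
  have "K ** H = H ** L" using assms by (metis H_cancel matrix_mul_assoc)
  \<comment> \<open>Products are normalised to the left, so the relation must also be available
    behind a left factor.\<close>
  then have a: "X ** K ** H = X ** H ** L" for X :: "complex^(2 + 2)^'a"
    by (metis matrix_mul_assoc)
  show ?thesis
    by (cases Z rule: blk_cases)
      (simp add: even_conj_blk sigma_blk_general dagger_mult H_dagger mat_ring assms a)
qed

lemma real_superalg_iso_fixpts:
  assumes K: "herm_invol K" and L: "herm_invol L" and HK: "H ** K = L ** H"
  shows "real_superalg_iso (fixpts (sigma K) sl41) (fixpts (sigma L) sl41)" (is "real_superalg_iso ?S ?T")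
proof -
  have KH: "H ** L = K ** H" using HK by (metis H_cancel matrix_mul_assoc)
  have st: "even_conj H Z \<in> ?T" if "Z \<in> ?S" for Z
    using that even_conj_sigma[OF HK, of Z] by (simp add: fixpts_def even_conj_sl41)
  have ts: "even_conj H Z \<in> ?S" if "Z \<in> ?T" for Z
    using that even_conj_sigma[OF KH, of Z] by (simp add: fixpts_def even_conj_sl41)
  have img: "even_conj H ` (?S \<inter> P) = ?T \<inter> P"
    if P: "\<And>Z. Z \<in> P \<Longrightarrow> even_conj H Z \<in> P" for P
  proof
    show "?T \<inter> P \<subseteq> even_conj H ` (?S \<inter> P)"
    proof
      fix Z assume "Z \<in> ?T \<inter> P"
      then have "even_conj H Z \<in> ?S \<inter> P" using ts P by blast
      then show "Z \<in> even_conj H ` (?S \<inter> P)"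
        by (rule image_eqI[rotated]) (simp add: even_conj_even_conj)
    qed
  qed (use st P in blast)
  have "bij_betw (even_conj H) ?S ?T"
    by (rule bij_betwI[of _ _ _ "even_conj H"]) (auto simp: st ts even_conj_even_conj)
  moreover have "even_conj H ` (?S \<inter> even_sl41) = ?T \<inter> even_sl41"
    "even_conj H ` (?S \<inter> odd_sl41) = ?T \<inter> odd_sl41"
    by (rule img; simp add: even_sl41_iff odd_sl41_iff even_conj_sl41 even_conj_parity)+
  ultimately show ?thesis
    using herm_invol.real_subsuperalg_fixpts[OF K] herm_invol.real_subsuperalg_fixpts[OF L]
    unfolding real_superalg_iso_def
    by (intro conjI exI[of _ "even_conj H"]) (simp_all add: even_conj_add even_conj_scaleR even_conj_sbr)
qed

end

text \<open>The columns are unit eigenvectors of \<open>FF\<close>, for the eigenvalue 1 in the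
  first block and -1 in the second, so \<open>UU\<close> diagonalises \<open>FF\<close> to
  \<open>JJ\<close>.\<close>

definition UU :: mat4 where
  "UU = (1 / sqrt 2) *\<^sub>R blk (mat 1) (mat 1) (mat 1) (- mat 1)"

lemma herm_invol_UU: "herm_invol UU"
proof -
  have "(1/2) *\<^sub>R (mat 1 + mat 1 :: mat2) = mat 1"
    by (simp add: vec_eq_iff mat_def)
  then show ?thesis
    by unfold_locales (simp_all add: UU_def dagger_simps dagger_blk dagger_mat blk_mult
      matrix_mult_scaleR blk_scaleR mat_ring flip: blk_mat1)
qed

lemma UU_FF: "UU ** FF = JJ ** UU"
  by (simp add: UU_def FF_def JJ_def matrix_mult_scaleR blk_mult mat_ring)

lemma su22_1_iso: "real_superalg_iso (fixpts (sigma FF) sl41) su22_1"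
  unfolding su22_1_def
  using herm_invol.real_superalg_iso_fixpts[OF herm_invol_UU herm_invol_FF herm_invol_JJ UU_FF] .

section \<open>Invariant subspaces and the big cell\<close>

lemma FF_mult:
  "FF ** blk A B C D ** FF = blk D C B A"
  "FF ** vstack P Q = vstack Q P" "hstack R S ** FF = hstack S R"
  by (simp_all add: FF_def blk_mult stack_mult)

text \<open>The zero patterns can be read off here: the off-diagonal even blocks stay in place, the
  diagonal ones are exchanged, and \<open>P\<close> is exchanged with \<open>S\<close> and
  \<open>Q\<close> with \<open>R\<close>. Both \<open>pp\<close> and \<open>nn\<close> are stable
  under this.\<close>

lemma sigma_FF_blk: "sigma FF (blk (blk A B C D) (vstack P Q) (hstack R S) E) =
    blk (blk (- D\<^sup>\<dagger>) (- B\<^sup>\<dagger>) (- C\<^sup>\<dagger>) (- A\<^sup>\<dagger>)) (\<i> *\<^sub>m vstack (S\<^sup>\<dagger>) (R\<^sup>\<dagger>))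
      (\<i> *\<^sub>m hstack (Q\<^sup>\<dagger>) (P\<^sup>\<dagger>)) (- E\<^sup>\<dagger>)"
  by (simp add: sigma_blk_general dagger_blk dagger_stack FF_mult blk_minus)

lemma sigma_FF_even: "sigma FF (blk (blk A B C D) 0 0 E) =
    blk (blk (- D\<^sup>\<dagger>) (- B\<^sup>\<dagger>) (- C\<^sup>\<dagger>) (- A\<^sup>\<dagger>)) 0 0 (- E\<^sup>\<dagger>)"
  by (simp add: sigma_blk_general dagger_blk dagger_simps FF_mult blk_minus)

interpretation FF: herm_invol FF by (rule herm_invol_FF)

lemma sigma_FF_pp: "sigma FF ` pp = pp"
proof (rule FF.image_sigma_eq)
  fix Z assume Z: "Z \<in> pp"
  then have "sigma FF Z \<in> sl41" using FF.sigma_sl41 pp_iff by blast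
  moreover obtain L M R \<alpha> \<beta> c where "Z = blk (blk L 0 M R) (vstack 0 \<alpha>) (hstack \<beta> 0) (mat c)"
    using Z by (auto simp: pp_def)
  ultimately show "sigma FF Z \<in> pp"
    unfolding pp_iff by (auto simp: sigma_FF_blk stack_arith dagger_simps)
qed

lemma sigma_FF_nn: "sigma FF ` nn = nn"
proof (rule FF.image_sigma_eq)
  fix Z assume "Z \<in> nn"
  then obtain A \<gamma> \<delta> where "Z = blk (blk 0 A 0 0) (vstack \<gamma> 0) (hstack 0 \<delta>) 0"
    by (auto simp: nn_def)
  then show "sigma FF Z \<in> nn"
    unfolding nn_def by (auto simp: sigma_FF_blk stack_arith dagger_simps)
qed

lemma big_cell_eq: "big_cell = range cell"
proof -
  have "Z \<in> range cell" if "Z \<in> nn" "evp Z = Z" for Z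
    using that by (auto simp: nn_def evp_blk cell_def)
  moreover have "cell A \<in> nn" for A
    unfolding nn_def cell_def mem_Collect_eq by (metis zero_stack(1,2))
  moreover have "cell A \<in> even_sl41" for A
    by (simp add: even_sl41_iff sl41_alt cell_def evp_blk trace_blk) (simp add: trace_def)
  ultimately show ?thesis
    unfolding big_cell_def using even_sl41_iff by (intro equalityI subsetI) auto
qed

lemma sigma_FF_cell: "sigma FF (cell A) = cell (- A\<^sup>\<dagger>)"
  by (simp add: cell_def sigma_FF_even dagger_simps)

lemma cell_eq_iff: "cell A = cell B \<longleftrightarrow> A = B"
  by (simp add: cell_def)

lemma sigma_FF_big_cell: "sigma FF ` big_cell = big_cell"
  by (rule FF.image_sigma_eq) (auto simp: big_cell_eq sigma_FF_cell)

lemma fixpts_big_cell: "fixpts (sigma FF) big_cell = {cell A | A. A\<^sup>\<dagger> = - A}"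
proof -
  have "- A\<^sup>\<dagger> = A \<longleftrightarrow> A\<^sup>\<dagger> = - A" for A :: mat2
    by (metis minus_minus)
  then show ?thesis
    by (auto simp: fixpts_def big_cell_eq sigma_FF_cell cell_eq_iff)
qed

section \<open>The group \<open>SL(2)\<close>\<close>

definition adj2 :: "mat2 \<Rightarrow> mat2" where
  "adj2 A = mat (trace A) - A"

lemmas mat2_simps = vec_eq_iff forall_2 sum_2 det_2 trace_def mat_def adj2_def
  matrix_matrix_mult_def dagger_def

text \<open>The Cayley-Hamilton identity in dimension two.\<close>

lemma adj2_right: "A ** adj2 A = mat (det A)" and adj2_left: "adj2 A ** A = mat (det A)"
  by (simp_all add: mat2_simps algebra_simps)

lemma adj2_mult: "adj2 (A ** B) = adj2 B ** adj2 A"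
  by (simp add: mat2_simps algebra_simps)

lemma adj2_adj2: "adj2 (adj2 A) = A"
  by (simp add: mat2_simps)

lemma adj2_dagger: "adj2 (A\<^sup>\<dagger>) = (adj2 A)\<^sup>\<dagger>"
  by (simp add: mat2_simps)

lemma det_adj2: "det (adj2 A) = det A"
  by (simp add: mat2_simps algebra_simps)

lemma det_dagger2: "det (A\<^sup>\<dagger>) = cnj (det A)" for A :: mat2
  by (simp add: mat2_simps)

lemma adj2_add: "adj2 (A + B) = adj2 A + adj2 B"
  by (simp add: mat2_simps)

lemma adj2_scaleR: "adj2 (r *\<^sub>R A) = r *\<^sub>R adj2 A"
  by (simp add: mat2_simps algebra_simps)

lemma adj2_traceless: "trace A = 0 \<Longrightarrow> adj2 A = - A"
  by (simp add: adj2_def mat_arith)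

text \<open>\<open>matrix_inv\<close> is a choice of a two-sided inverse; exhibiting
  \<open>B\<close> makes its defining property available.\<close>

lemma matrix_inv_unique:
  fixes A :: "complex^'n^'n"
  assumes "A ** B = mat 1" "B ** A = mat 1"
  shows "matrix_inv A = B"
proof -
  have "A ** matrix_inv A = mat 1 \<and> matrix_inv A ** A = mat 1"
    unfolding matrix_inv_def by (rule someI[of _ B]) (use assms in simp)
  then show ?thesis
    using assms by (metis matrix_mul_assoc matrix_mul_lid matrix_mul_rid)
qed

lemma matrix_inv_SL2: "det x = 1 \<Longrightarrow> matrix_inv x = adj2 x"
  by (rule matrix_inv_unique) (simp_all add: adj2_left adj2_right)

lemma nilpotent2:
  fixes N :: mat2
  assumes "trace N = 0" "det N = 0"
  shows "N ** N = 0"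
  using adj2_right[of N] adj2_traceless[OF assms(1)] assms(2) by (simp add: mat_ring mat_arith)

lemma det_unipotent2:
  fixes N :: mat2
  assumes "trace N = 0" "det N = 0"
  shows "det (mat 1 + s *\<^sub>R N) = 1"
proof -
  have "det (mat 1 + s *\<^sub>R N) = 1 + of_real s * trace N + (of_real s)\<^sup>2 * det N"
    by (simp add: mat2_simps scaleR_conv_of_real[where 'a = complex])
      (simp add: algebra_simps power2_eq_square)
  then show ?thesis using assms by simp
qed

section \<open>Generation of SL(2) by unipotent elements\<close>

definition elem12 :: "complex \<Rightarrow> mat2" where
  "elem12 b = (\<chi> i j. if i = 1 \<and> j = 2 then b else 0)"
definition elem21 :: "complex \<Rightarrow> mat2" where
  "elem21 c = (\<chi> i j. if i = 2 \<and> j = 1 then c else 0)"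

lemma elem_nilpotent:
  "trace (elem12 b) = 0" "det (elem12 b) = 0" "trace (elem21 b) = 0" "det (elem21 b) = 0"
  by (simp_all add: mat2_simps elem12_def elem21_def)

text \<open>A matrix of determinant 1 with nonzero lower left entry is a product of three elementary
  unipotents; any other one reaches this case after one row operation.\<close>

lemma SL2_unipotent_induct:
  assumes x: "det x = 1"
    and unip: "\<And>N. trace N = 0 \<Longrightarrow> det N = 0 \<Longrightarrow> P (mat 1 + N)"
    and mult: "\<And>x y. det x = 1 \<Longrightarrow> det y = 1 \<Longrightarrow> P x \<Longrightarrow> P y \<Longrightarrow> P (x ** y)"
  shows "P (x :: mat2)"
proof -
  have d: "det (mat 1 + N) = 1" if "trace N = 0" "det N = 0" for N :: mat2
    using det_unipotent2[OF that, of 1] by simp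
  have *: "P x" if x: "det x = 1" and c: "x $ 2 $ 1 \<noteq> 0" for x
  proof -
    define a b c d' where "a = x $ 1 $ 1" and "b = x $ 1 $ 2" and "c = x $ 2 $ 1" and "d' = x $ 2 $ 2"
    have "a * d' - b * c = 1" and "c \<noteq> 0"
      using x \<open>x $ 2 $ 1 \<noteq> 0\<close> by (simp_all add: det_2 a_def b_def c_def d'_def)
    then have "b * c = a * d' - 1" by algebra
    then have b: "b = (a * d' - 1) / c" using \<open>c \<noteq> 0\<close> by (simp add: field_simps)
    \<comment> \<open>The parameters are forced by the entries \<open>a\<close>, \<open>c\<close>
      and \<open>d'\<close>; the entry \<open>b\<close> then agrees because the determinant is
      1.\<close>
    have "x = ((mat 1 + elem12 ((a - 1) / c)) ** (mat 1 + elem21 c)) ** (mat 1 + elem12 ((d' - 1) / c))"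
      using b \<open>c \<noteq> 0\<close>
      by (simp add: mat2_simps elem12_def elem21_def flip: a_def b_def c_def d'_def)
        (simp add: field_simps)
    then show ?thesis
      using unip mult elem_nilpotent d by (simp add: det_mul)
  qed
  show ?thesis
  proof (cases "x $ 2 $ 1 = 0")
    case True
    \<comment> \<open>Adding the first row to the second puts the entry \<open>x $ 1 $ 1\<close> in
      the lower left corner; it is nonzero because \<open>x\<close> is triangular with determinant
      1.\<close>
    define y where "y = (mat 1 + elem21 1) ** x"
    have "x $ 1 $ 1 \<noteq> 0" using x True by (auto simp: det_2)
    then have "y $ 2 $ 1 \<noteq> 0"
      using True by (simp add: y_def mat2_simps elem21_def)
    moreover have "det y = 1" using x d elem_nilpotent by (simp add: y_def det_mul)
    moreover have "x = (mat 1 + elem21 (- 1)) ** y"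
      by (simp add: y_def mat2_simps elem21_def)
    ultimately show ?thesis
      using * unip mult elem_nilpotent d by metis
  qed (use x * in blast)
qed

section \<open>One-parameter groups with nilpotent generator\<close>

lemma bounded_linear_mat_mult:
  fixes A :: "complex^'n^'n"
  shows "bounded_linear (\<lambda>X :: complex^'n^'n. A ** X)" "bounded_linear (\<lambda>X :: complex^'n^'n. X ** A)"
  unfolding linear_conv_bounded_linear[symmetric]
  by (auto intro!: linearI simp: matrix_add_ldistrib matrix_add_rdistrib matrix_mult_scaleR)

text \<open>The homomorphism law spreads the derivative at 0 to f' = fW everywhere. Then (fW)' = fWW
  = 0, so fW is constantly W and f' = W.\<close>

lemma one_parameter_group_nilpotent:
  fixes f :: "real \<Rightarrow> complex^'n^'n"
  assumes hom: "\<And>s t. f (s + t) = f s ** f t" and f0: "f 0 = mat 1"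
    and deriv: "(f has_vector_derivative W) (at 0)" and nil: "W ** W = 0"
  shows "f s = mat 1 + s *\<^sub>R W"
proof -
  have f': "(f has_vector_derivative f s ** W) (at s)" for s
  proof -
    have "((\<lambda>t. t - s) has_vector_derivative 1) (at s)"
      by (auto intro!: derivative_eq_intros)
    moreover have "(f has_vector_derivative W) (at (s - s))" using deriv by simp
    ultimately have "(f \<circ> (\<lambda>t. t - s) has_vector_derivative 1 *\<^sub>R W) (at s)"
      by (rule vector_diff_chain_at)
    from bounded_linear.has_vector_derivative[OF bounded_linear_mat_mult(1)[of "f s"] this]
    have "((\<lambda>t. f s ** f (t - s)) has_vector_derivative f s ** W) (at s)" by simp
    \<comment> \<open>Near \<open>s\<close> the curve is the left translate by \<open>f s\<close> of
      the curve near 0.\<close>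
    moreover have "f s ** f (t - s) = f t" for t
      by (simp flip: hom)
    ultimately show ?thesis by simp
  qed
  have "((\<lambda>t. f t ** W) has_vector_derivative 0) (at t)" for t
    using bounded_linear.has_vector_derivative[OF bounded_linear_mat_mult(2)[of W] f'[of t]]
    by (simp add: nil flip: matrix_mul_assoc)
  then obtain C where "\<And>t. f t ** W = C"
    using has_vector_derivative_zero_constant[of UNIV "\<lambda>t. f t ** W"] by auto
  then have fW: "f t ** W = W" for t
    by (metis f0 matrix_mul_lid)
  have "((\<lambda>t. f t - t *\<^sub>R W) has_vector_derivative 0) (at t)" for t
    using f'[of t] by (auto intro!: derivative_eq_intros simp: fW)
  then obtain C where C: "\<And>t. f t - t *\<^sub>R W = C"
    using has_vector_derivative_zero_constant[of UNIV "\<lambda>t. f t - t *\<^sub>R W"] by auto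
  from C[of 0] C[of s] f0 show ?thesis by (simp add: algebra_simps)
qed

section \<open>The induced conjugation of \<open>L\<^sub>0\<close>\<close>

definition diag2 :: "mat2 \<Rightarrow> mat2 \<Rightarrow> mat5" where
  "diag2 x y = blk (blk x 0 0 y) 0 0 (mat 1)"

lemma L0_eq: "L0 = {diag2 x y | x y. det x = 1 \<and> det y = 1}"
  by (simp add: L0_def diag2_def)

lemma diag2_mult: "diag2 x y ** diag2 x' y' = diag2 (x ** x') (y ** y')"
  by (simp add: diag2_def blk_mult)

lemma diag2_mat1: "diag2 (mat 1) (mat 1) = mat 1"
  by (simp add: diag2_def blk_mat1)

lemma diag2_eq_iff: "diag2 x y = diag2 x' y' \<longleftrightarrow> x = x' \<and> y = y'"
  by (simp add: diag2_def)

text \<open>Copying the last block keeps the map linear and serves both the group, where that block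
  is 1, and the Lie algebra, where it is 0.\<close>

definition L0_conj_lin :: "mat5 \<Rightarrow> mat5" where
  "L0_conj_lin Z = blk (blk ((adj2 (lr (ul Z)))\<^sup>\<dagger>) 0 0 ((adj2 (ul (ul Z)))\<^sup>\<dagger>)) 0 0 (lr Z)"

lemma L0_conj_lin_diag2: "L0_conj_lin (diag2 x y) = diag2 ((adj2 y)\<^sup>\<dagger>) ((adj2 x)\<^sup>\<dagger>)"
  by (simp add: L0_conj_lin_def diag2_def)

lemma ul_lr_linear:
  "ul (Z + W) = ul Z + ul W" "lr (Z + W) = lr Z + lr W"
  "ul (r *\<^sub>R Z) = r *\<^sub>R ul Z" "lr (r *\<^sub>R Z) = r *\<^sub>R lr Z"
  by (simp_all add: ul_def lr_def vec_eq_iff)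

lemma bounded_linear_L0_conj_lin: "bounded_linear L0_conj_lin"
  unfolding linear_conv_bounded_linear[symmetric]
proof (rule linearI)
  show "L0_conj_lin (Z + W) = L0_conj_lin Z + L0_conj_lin W" for Z W
    by (simp add: L0_conj_lin_def blk_add adj2_add dagger_simps ul_lr_linear)
  show "L0_conj_lin (r *\<^sub>R Z) = r *\<^sub>R L0_conj_lin Z" for r Z
    by (simp add: L0_conj_lin_def blk_scaleR adj2_scaleR dagger_simps ul_lr_linear)
qed

text \<open>The restriction supplies the value \<open>undefined\<close> off \<open>L0\<close> that
  \<open>induced_by\<close> prescribes.\<close>

definition L0_conj :: "mat5 \<Rightarrow> mat5" where
  "L0_conj = restrict L0_conj_lin L0"

lemma L0_conj_diag2:
  assumes "det x = 1" "det y = 1"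
  shows "L0_conj (diag2 x y) = diag2 ((adj2 y)\<^sup>\<dagger>) ((adj2 x)\<^sup>\<dagger>)"
  using assms by (auto simp: L0_conj_def L0_eq L0_conj_lin_diag2)

lemma induced_by_L0_conj: "induced_by (sigma FF) L0_conj"
  unfolding induced_by_def
proof (intro conjI allI impI ballI)
  have mem: "L0_conj g \<in> L0" if "g \<in> L0" for g
    using that by (force simp: L0_eq L0_conj_diag2 det_dagger2 det_adj2)
  then show "L0_conj \<in> L0 \<rightarrow>\<^sub>E L0"
    by (auto simp: L0_conj_def)
  show "L0_conj (g ** h) = L0_conj g ** L0_conj h" if "g \<in> L0" "h \<in> L0" for g h
    using that by (auto simp: L0_eq L0_conj_diag2 diag2_mult det_mul adj2_mult dagger_mult)
  show "L0_conj (L0_conj g) = g" if "g \<in> L0" for g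
    using that
    by (auto simp: L0_eq L0_conj_diag2 det_dagger2 det_adj2 adj2_dagger adj2_adj2 dagger_simps)
next
  fix \<gamma> :: "real \<Rightarrow> mat5" and Z
  assume a: "(\<forall>t. \<gamma> t \<in> L0) \<and> \<gamma> 0 = mat 1 \<and> Z \<in> lie0 \<and> (\<gamma> has_vector_derivative Z) (at 0)"
  \<comment> \<open>On traceless blocks \<open>adj2\<close> is negation, so the inverse dagger of
    the group becomes the negative dagger of \<open>sigma FF\<close>.\<close>
  have "L0_conj_lin Z = sigma FF Z"
    using a by (auto simp: lie0_def L0_conj_lin_def sigma_FF_even adj2_traceless dagger_simps)
  \<comment> \<open>The curve lies in \<open>L0\<close>, so the restricted map may be replaced by
    the linear one, which is its own derivative.\<close>
  moreover have "(\<lambda>t. L0_conj (\<gamma> t)) = (\<lambda>t. L0_conj_lin (\<gamma> t))"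
    using a by (simp add: L0_conj_def)
  ultimately show "((\<lambda>t. L0_conj (\<gamma> t)) has_vector_derivative sigma FF Z) (at 0)"
    using a bounded_linear.has_vector_derivative[OF bounded_linear_L0_conj_lin, of \<gamma> Z "at 0"] by simp
qed

section \<open>Uniqueness of the induced conjugation\<close>

lemma induced_by_one:
  assumes "induced_by \<sigma> \<Sigma>"
  shows "\<Sigma> (mat 1) = mat 1"
proof -
  have one: "mat 1 \<in> L0" unfolding L0_eq diag2_mat1[symmetric] by force
  have "\<Sigma> (\<Sigma> (mat 1)) = mat 1" "\<Sigma> (mat 1) \<in> L0"
    using assms one by (auto simp: induced_by_def)
  \<comment> \<open>The involution takes the place of cancellation in the group: the left side is
    also \<open>\<Sigma> (\<Sigma> (mat 1))\<close>, that is 1.\<close>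
  then have "\<Sigma> (mat 1 ** \<Sigma> (mat 1)) = \<Sigma> (mat 1) ** mat 1"
    using assms one unfolding induced_by_def by metis
  then show ?thesis
    using \<open>\<Sigma> (\<Sigma> (mat 1)) = mat 1\<close> by simp
qed

lemma induced_by_unipotent:
  assumes ind: "induced_by \<sigma> \<Sigma>" and Z: "Z \<in> lie0" "Z ** Z = 0" "\<sigma> Z ** \<sigma> Z = 0"
    and L0: "\<And>s. mat 1 + s *\<^sub>R Z \<in> L0"
  shows "\<Sigma> (mat 1 + Z) = mat 1 + \<sigma> Z"
proof -
  define f where "f s = \<Sigma> (mat 1 + s *\<^sub>R Z)" for s :: real
  have "(mat 1 + (s + t) *\<^sub>R Z) = (mat 1 + s *\<^sub>R Z) ** (mat 1 + t *\<^sub>R Z)" for s t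
    by (simp add: matrix_add_ldistrib matrix_add_rdistrib matrix_mult_scaleR Z algebra_simps)
  then have "f (s + t) = f s ** f t" for s t
    using ind L0 by (simp add: f_def induced_by_def)
  moreover have "f 0 = mat 1" by (simp add: f_def induced_by_one[OF ind])
  moreover have "(f has_vector_derivative \<sigma> Z) (at 0)"
  proof -
    have "((\<lambda>s. mat 1 + s *\<^sub>R Z) has_vector_derivative Z) (at 0)"
      by (auto intro!: derivative_eq_intros)
    then show ?thesis
      using ind L0 Z(1) unfolding f_def induced_by_def by simp
  qed
  ultimately have "f 1 = mat 1 + 1 *\<^sub>R \<sigma> Z"
    using Z(3) by (rule one_parameter_group_nilpotent)
  then show ?thesis by (simp add: f_def)
qed

lemma induced_by_unique:
  assumes ind: "induced_by (sigma FF) \<Sigma>" "induced_by (sigma FF) \<Sigma>'"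
  shows "\<Sigma> = \<Sigma>'"
proof -
  have u: "\<Sigma> (diag2 (mat 1 + N) (mat 1)) = \<Sigma>' (diag2 (mat 1 + N) (mat 1))"
      "\<Sigma> (diag2 (mat 1) (mat 1 + N)) = \<Sigma>' (diag2 (mat 1) (mat 1 + N))"
    if N: "trace N = 0" "det N = 0" for N
  proof -
    have NN: "N ** N = 0" using nilpotent2[OF N] .
    have tr0: "trace (0 :: mat2) = 0" by (simp add: trace_def)
    define Z1 Z2 :: mat5 where "Z1 = blk (blk N 0 0 0) 0 0 0" and "Z2 = blk (blk 0 0 0 N) 0 0 0"
    have d: "mat 1 + s *\<^sub>R Z1 = diag2 (mat 1 + s *\<^sub>R N) (mat 1)"
      "mat 1 + s *\<^sub>R Z2 = diag2 (mat 1) (mat 1 + s *\<^sub>R N)" for s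
      by (simp_all add: Z1_def Z2_def diag2_def blk_scaleR blk_add flip: diag2_mat1)
    have L0: "mat 1 + s *\<^sub>R Z1 \<in> L0" "mat 1 + s *\<^sub>R Z2 \<in> L0" for s
      using det_unipotent2[OF N, of s] unfolding d L0_eq by force+
    have lie: "Z1 \<in> lie0" "Z2 \<in> lie0"
      unfolding lie0_def Z1_def Z2_def using N tr0 by blast+
    have nil: "Z1 ** Z1 = 0" "Z2 ** Z2 = 0"
      by (simp_all add: Z1_def Z2_def blk_mult NN zero_stack)
    \<comment> \<open>\<open>sigma FF\<close> moves \<open>N\<close> to the other diagonal block as
      its negative dagger, whose square is the dagger of \<open>N ** N\<close>.\<close>
    have snil: "sigma FF Z1 ** sigma FF Z1 = 0" "sigma FF Z2 ** sigma FF Z2 = 0"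
      by (simp_all add: Z1_def Z2_def sigma_FF_even blk_mult dagger_simps mat_ring NN zero_stack
          flip: dagger_mult)
    show "\<Sigma> (diag2 (mat 1 + N) (mat 1)) = \<Sigma>' (diag2 (mat 1 + N) (mat 1))"
      using induced_by_unipotent[OF ind(1) lie(1) nil(1) snil(1) L0(1)]
        induced_by_unipotent[OF ind(2) lie(1) nil(1) snil(1) L0(1)] d(1)[of 1] by simp
    show "\<Sigma> (diag2 (mat 1) (mat 1 + N)) = \<Sigma>' (diag2 (mat 1) (mat 1 + N))"
      using induced_by_unipotent[OF ind(1) lie(2) nil(2) snil(2) L0(2)]
        induced_by_unipotent[OF ind(2) lie(2) nil(2) snil(2) L0(2)] d(2)[of 1] by simp
  qed
  have mult: "\<Sigma> (g ** h) = \<Sigma>' (g ** h)"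
    if "g \<in> L0" "h \<in> L0" "\<Sigma> g = \<Sigma>' g" "\<Sigma> h = \<Sigma>' h" for g h
    using ind that by (simp add: induced_by_def)
  have mem: "diag2 x y \<in> L0" if "det x = 1" "det y = 1" for x y
    using that by (auto simp: L0_eq)
  have 1: "\<Sigma> (diag2 x (mat 1)) = \<Sigma>' (diag2 x (mat 1))" if "det x = 1" for x
    using that
  proof (rule SL2_unipotent_induct)
    fix x y :: mat2
    assume "det x = 1" "det y = 1" "\<Sigma> (diag2 x (mat 1)) = \<Sigma>' (diag2 x (mat 1))"
      "\<Sigma> (diag2 y (mat 1)) = \<Sigma>' (diag2 y (mat 1))"
    then show "\<Sigma> (diag2 (x ** y) (mat 1)) = \<Sigma>' (diag2 (x ** y) (mat 1))"
      using mult[of "diag2 x (mat 1)" "diag2 y (mat 1)"] by (simp add: mem diag2_mult)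
  qed (rule u)
  have 2: "\<Sigma> (diag2 (mat 1) x) = \<Sigma>' (diag2 (mat 1) x)" if "det x = 1" for x
    using that
  proof (rule SL2_unipotent_induct)
    fix x y :: mat2
    assume "det x = 1" "det y = 1" "\<Sigma> (diag2 (mat 1) x) = \<Sigma>' (diag2 (mat 1) x)"
      "\<Sigma> (diag2 (mat 1) y) = \<Sigma>' (diag2 (mat 1) y)"
    then show "\<Sigma> (diag2 (mat 1) (x ** y)) = \<Sigma>' (diag2 (mat 1) (x ** y))"
      using mult[of "diag2 (mat 1) x" "diag2 (mat 1) y"] by (simp add: mem diag2_mult)
  qed (rule u)
  have "\<Sigma> g = \<Sigma>' g" if g_L0: "g \<in> L0" for g
  proof -
    obtain x y where g: "g = diag2 x y" "det x = 1" "det y = 1"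
      using g_L0 by (auto simp: L0_eq)
    then show ?thesis
      \<comment> \<open>diag(x, y) is the product of diag(x, 1) and diag(1, y), so the two factors
        of \<open>L0\<close> can be treated separately.\<close>
      using mult[of "diag2 x (mat 1)" "diag2 (mat 1) y"] 1 2 by (simp add: mem diag2_mult)
  qed
  then show ?thesis
    \<comment> \<open>Off \<open>L0\<close> both maps are \<open>undefined\<close>, so agreement on
      \<open>L0\<close> is enough.\<close>
    using ind unfolding induced_by_def by (intro PiE_ext[of \<Sigma> L0 "\<lambda>_. L0"]) auto
qed

lemma ex1_induced_by: "\<exists>!\<Sigma>. induced_by (sigma FF) \<Sigma>"
  using induced_by_L0_conj induced_by_unique by blast

section \<open>The fixed group of \<open>L0\<close> and its action on the cell\<close>

lemma L0_fix_eq: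
  "L0_fix (sigma FF) = {blk (blk x 0 0 (matrix_inv (x\<^sup>\<dagger>))) 0 0 (mat 1) | x :: mat2. det x = 1}"
proof -
  \<comment> \<open>Unique existence is what gives the definite description in \<open>L0_fix\<close>
    its value.\<close>
  have The: "(THE \<Sigma>. induced_by (sigma FF) \<Sigma>) = L0_conj"
    using ex1_induced_by induced_by_L0_conj by (rule the1_equality[of "induced_by (sigma FF)"])
  have "L0_fix (sigma FF) = {diag2 x ((adj2 x)\<^sup>\<dagger>) | x. det x = 1}"
  proof (rule set_eqI)
    fix g
    have "g \<in> L0_fix (sigma FF) \<longleftrightarrow>
        (\<exists>x y. g = diag2 x y \<and> det x = 1 \<and> det y = 1 \<and> (adj2 y)\<^sup>\<dagger> = x \<and> (adj2 x)\<^sup>\<dagger> = y)"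
      unfolding L0_fix_def The by (auto simp: L0_eq L0_conj_diag2 diag2_eq_iff)
    \<comment> \<open>The two fixed-point equations are equivalent because the adjugate followed by
      the dagger is an involution, so only the one that determines \<open>y\<close> remains.\<close>
    also have "\<dots> \<longleftrightarrow> (\<exists>x. g = diag2 x ((adj2 x)\<^sup>\<dagger>) \<and> det x = 1)"
      by (auto simp: det_dagger2 det_adj2 adj2_dagger adj2_adj2 dagger_simps)
    finally show "g \<in> L0_fix (sigma FF) \<longleftrightarrow> g \<in> {diag2 x ((adj2 x)\<^sup>\<dagger>) | x. det x = 1}"
      by simp
  qed
  also have "\<dots> = {diag2 x (matrix_inv (x\<^sup>\<dagger>)) | x. det x = 1}"
    by (metis (no_types, opaque_lifting) matrix_inv_SL2 det_dagger2 adj2_dagger complex_cnj_one)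
  finally show ?thesis by (simp add: diag2_def)
qed

lemma conj_act_cell:
  assumes x: "det x = 1"
  shows "conj_act (blk (blk x 0 0 (matrix_inv (x\<^sup>\<dagger>))) 0 0 (mat 1)) (cell A) = cell (x ** A ** x\<^sup>\<dagger>)"
proof -
  have dd: "det (x\<^sup>\<dagger>) = 1" using x by (simp add: det_dagger2)
  \<comment> \<open>The lower block of the group element is the inverse of
    \<open>x\<^sup>\<dagger>\<close>, so inverting it leaves \<open>x\<^sup>\<dagger>\<close> as the
    right factor of the action.\<close>
  have "matrix_inv (diag2 x (adj2 (x\<^sup>\<dagger>))) = diag2 (adj2 x) (x\<^sup>\<dagger>)"
    by (rule matrix_inv_unique) (simp_all add: diag2_mult adj2_left adj2_right x dd diag2_mat1)
  then show ?thesis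
    by (simp add: conj_act_def matrix_inv_SL2[OF dd] cell_def diag2_def blk_mult)
qed

theorem proposition4p3:
  "\<exists>\<sigma> :: mat5 \<Rightarrow> mat5.
     conjugation \<sigma>
   \<and> real_superalg_iso (fixpts \<sigma> sl41) su22_1
   \<and> (\<sigma> ` pp = pp \<and> \<sigma> ` nn = nn \<and> \<sigma> ` even_sl41 = even_sl41 \<and> \<sigma> ` odd_sl41 = odd_sl41)
   \<and> \<sigma> ` big_cell = big_cell
   \<and> fixpts \<sigma> big_cell = {cell A | A. A\<^sup>\<dagger> = - A}
   \<and> ((\<exists>!\<Sigma>. induced_by \<sigma> \<Sigma>)
      \<and> L0_fix \<sigma> = {blk (blk x 0 0 (matrix_inv (x\<^sup>\<dagger>))) 0 0 (mat 1) | x :: mat2. det x = 1}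
      \<and> (\<forall>(x :: mat2) A. det x = 1 \<and> cell A \<in> fixpts \<sigma> big_cell \<longrightarrow>
           conj_act (blk (blk x 0 0 (matrix_inv (x\<^sup>\<dagger>))) 0 0 (mat 1)) (cell A) = cell (x ** A ** x\<^sup>\<dagger>)
           \<and> cell (x ** A ** x\<^sup>\<dagger>) \<in> fixpts \<sigma> big_cell))
   \<and> (\<forall>X \<mu> \<nu> x. trace X = x \<longrightarrow>
        \<sigma> (blk X \<mu> \<nu> (mat x)) =
          blk (- (FF ** X\<^sup>\<dagger> ** FF)) (\<i> *\<^sub>m (FF ** \<nu>\<^sup>\<dagger>)) (\<i> *\<^sub>m (\<mu>\<^sup>\<dagger> ** FF)) (mat (- cnj x)))"
proof -
  \<comment> \<open>The dagger of \<open>x ** A ** x\<^sup>\<dagger>\<close> is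
    \<open>x ** A\<^sup>\<dagger> ** x\<^sup>\<dagger>\<close>, so skew-hermitian matrices are
    preserved for every \<open>x\<close>.\<close>
  have skew: "cell (x ** A ** x\<^sup>\<dagger>) \<in> fixpts (sigma FF) big_cell"
    if "cell A \<in> fixpts (sigma FF) big_cell" for x A
    using that
    by (auto simp: fixpts_big_cell cell_eq_iff dagger_mult dagger_simps matrix_mul_assoc
        matrix_mult_minus)
  show ?thesis
    by (rule exI[of _ "sigma FF"])
      (intro conjI allI impI FF.conjugation_sigma su22_1_iso sigma_FF_pp sigma_FF_nn
        FF.sigma_even FF.sigma_odd sigma_FF_big_cell fixpts_big_cell ex1_induced_by L0_fix_eq
        sigma_blk, auto simp: conj_act_cell skew)
qed

end
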